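(* For each integer $n\ge 2$, let $\rho_n$ denote the number of conjugacy classes of involutions in the twin group $T_n$. Then $$\rho_n = 1+\rho_{n-1}+\rho_{n-2}$$ for all $n\ge 4$, where $\rho_2=1$ and $\rho_3=2$.
   Context: For an integer $n\ge 2$, the twin group $T_n$ is the group generated by $s_1,\dots,s_{n-1}$ with defining relations $s_i^2=1$ for all $i$, and $s_is_j=s_js_i$ whenever $|i-j|\ge 2$. An involution is an element of order $2$. *)

theory Defs
  imports "HOL-Algebra.Algebra"
begin

section \<open>Group presentations\<close>

text \<open>
  A word is a list of letters; the letter \<open>(s, True)\<close> stands for the generator \<open>s\<close> and
  \<open>(s, False)\<close> for its formal inverse.
\<close>

type_synonym 'a word = "('a \<times> bool) list"

definition words :: "'a set \<Rightarrow> 'a word set" where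
  "words S = lists (S \<times> UNIV)"

text \<open>
  The least congruence on the monoid of words over \<open>S\<close> that cancels adjacent mutually inverse
  letters and identifies the two sides of every defining relation \<open>u = v\<close>, given as a pair
  \<open>(u, v) \<in> R\<close>.
\<close>

inductive_set pres_cong :: "'a set \<Rightarrow> ('a word \<times> 'a word) set \<Rightarrow> ('a word \<times> 'a word) set"
  for S :: "'a set" and R :: "('a word \<times> 'a word) set" where
  refl: "w \<in> words S \<Longrightarrow> (w, w) \<in> pres_cong S R"
| sym: "(u, v) \<in> pres_cong S R \<Longrightarrow> (v, u) \<in> pres_cong S R"
| trans: "(u, v) \<in> pres_cong S R \<Longrightarrow> (v, w) \<in> pres_cong S R \<Longrightarrow> (u, w) \<in> pres_cong S R"
| cancel: "x \<in> words S \<Longrightarrow> y \<in> words S \<Longrightarrow> s \<in> S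
    \<Longrightarrow> (x @ [(s, b), (s, \<not> b)] @ y, x @ y) \<in> pres_cong S R"
| relation: "x \<in> words S \<Longrightarrow> y \<in> words S \<Longrightarrow> (u, v) \<in> R \<Longrightarrow> u \<in> words S \<Longrightarrow> v \<in> words S
    \<Longrightarrow> (x @ u @ y, x @ v @ y) \<in> pres_cong S R"

definition presented_group ::
    "'a set \<Rightarrow> ('a word \<times> 'a word) set \<Rightarrow> 'a word set monoid" where
  "presented_group S R =
    \<lparr> carrier = words S // pres_cong S R,
      monoid.mult = (\<lambda>A B. \<Union>u\<in>A. \<Union>v\<in>B. pres_cong S R `` {u @ v}),
      one = pres_cong S R `` {[]} \<rparr>"

lemma words_append [simp]: "u @ v \<in> words S \<longleftrightarrow> u \<in> words S \<and> v \<in> words S"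
  by (auto simp: words_def)

lemma words_Nil [simp]: "[] \<in> words S"
  by (simp add: words_def)

lemma words_Cons [simp]: "(s, b) # w \<in> words S \<longleftrightarrow> s \<in> S \<and> w \<in> words S"
  by (auto simp: words_def)

lemma pres_cong_words: "(u, v) \<in> pres_cong S R \<Longrightarrow> u \<in> words S \<and> v \<in> words S"
  by (induction rule: pres_cong.induct) auto

lemma equiv_pres_cong: "equiv (words S) (pres_cong S R)"
  by (intro equivI refl_onI symI transI)
    (auto intro: pres_cong.refl pres_cong.sym pres_cong.trans dest: pres_cong_words)

lemma pres_cong_context:
  assumes "(u, v) \<in> pres_cong S R" "p \<in> words S" "q \<in> words S"
  shows "(p @ u @ q, p @ v @ q) \<in> pres_cong S R"
  using assms
proof (induction rule: pres_cong.induct)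
  case (refl w)
  then show ?case by (simp add: pres_cong.refl)
next
  case (sym u v)
  then show ?case by (blast intro: pres_cong.sym)
next
  case (trans u v w)
  then show ?case by (blast intro: pres_cong.trans)
next
  case (cancel x y s b)
  then show ?case using pres_cong.cancel[of "p @ x" S "y @ q" s b R] by simp
next
  case (relation x y u v)
  then show ?case using pres_cong.relation[of "p @ x" S "y @ q" u v R] by simp
qed

lemma pres_cong_append:
  assumes "(u, u') \<in> pres_cong S R" "(v, v') \<in> pres_cong S R"
  shows "(u @ v, u' @ v') \<in> pres_cong S R"
proof -
  have "(u @ v, u' @ v) \<in> pres_cong S R"
    using pres_cong_context[OF assms(1), of "[]" v] assms by (auto dest: pres_cong_words)
  moreover have "(u' @ v, u' @ v') \<in> pres_cong S R"
    using pres_cong_context[OF assms(2), of u' "[]"] assms by (auto dest: pres_cong_words)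
  ultimately show ?thesis by (rule pres_cong.trans)
qed

lemma presented_group_mult:
  assumes "u \<in> words S" "v \<in> words S"
  shows "pres_cong S R `` {u} \<otimes>\<^bsub>presented_group S R\<^esub> pres_cong S R `` {v}
    = pres_cong S R `` {u @ v}"
  using assms
  by (auto simp: presented_group_def intro: pres_cong.refl
      intro: pres_cong.trans pres_cong.sym pres_cong_append)

lemma words_inverse:
  assumes "w \<in> words S"
  shows "\<exists>w'\<in>words S. (w' @ w, []) \<in> pres_cong S R"
  using assms
proof (induction w)
  case Nil
  then show ?case by (auto intro!: bexI[of _ "[]"] pres_cong.refl)
next
  case (Cons a w)
  obtain s b where a: "a = (s, b)" by (cases a)
  from Cons a obtain w' where w': "w' \<in> words S" "(w' @ w, []) \<in> pres_cong S R" by auto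
  have "(w' @ [(s, \<not> b), (s, b)] @ w, w' @ w) \<in> pres_cong S R"
    using pres_cong.cancel[of w' S w s "\<not> b" R] Cons.prems a w' by simp
  then have "(w' @ [(s, \<not> b), (s, b)] @ w, []) \<in> pres_cong S R"
    using w' by (blast intro: pres_cong.trans)
  then show ?case
    using Cons.prems a w' by (intro bexI[of _ "w' @ [(s, \<not> b)]"]) auto
qed

lemma group_presented_group: "group (presented_group S R)"
proof (rule groupI)
  let ?G = "presented_group S R" and ?c = "\<lambda>w. pres_cong S R `` {w}"
  have carr: "A \<in> carrier ?G \<longleftrightarrow> (\<exists>w\<in>words S. A = ?c w)" for A
    by (auto simp: presented_group_def quotient_def)
  have one: "\<one>\<^bsub>?G\<^esub> = ?c []" by (simp add: presented_group_def)
  note m = presented_group_mult[of _ S _ R]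
  show "\<one>\<^bsub>?G\<^esub> \<in> carrier ?G" by (auto simp: carr one)
  show "A \<otimes>\<^bsub>?G\<^esub> B \<in> carrier ?G" if "A \<in> carrier ?G" "B \<in> carrier ?G" for A B
    using that m by (metis carr words_append)
  show "A \<otimes>\<^bsub>?G\<^esub> B \<otimes>\<^bsub>?G\<^esub> C = A \<otimes>\<^bsub>?G\<^esub> (B \<otimes>\<^bsub>?G\<^esub> C)"
    if "A \<in> carrier ?G" "B \<in> carrier ?G" "C \<in> carrier ?G" for A B C
    using that by (auto simp: carr m)
  show "\<one>\<^bsub>?G\<^esub> \<otimes>\<^bsub>?G\<^esub> A = A" if "A \<in> carrier ?G" for A
    using that by (auto simp: carr one m)
  show "\<exists>B\<in>carrier ?G. B \<otimes>\<^bsub>?G\<^esub> A = \<one>\<^bsub>?G\<^esub>" if A: "A \<in> carrier ?G" for A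
  proof -
    obtain w where w: "w \<in> words S" "A = ?c w" using A carr by blast
    obtain w' where w': "w' \<in> words S" "(w' @ w, []) \<in> pres_cong S R"
      using words_inverse[OF w(1)] by blast
    have "?c w' \<otimes>\<^bsub>?G\<^esub> A = ?c []"
      using w w' m equiv_class_eq[OF equiv_pres_cong w'(2)] by simp
    then show ?thesis using carr one w' by auto
  qed
qed

section \<open>Twin groups\<close>

definition twin_relations :: "nat \<Rightarrow> (nat word \<times> nat word) set" where
  "twin_relations n =
    {([(i, True), (i, True)], []) | i. i \<in> {1..<n}} \<union>
    {([(i, True), (j, True)], [(j, True), (i, True)]) | i j.
        i \<in> {1..<n} \<and> j \<in> {1..<n} \<and> \<bar>int i - int j\<bar> \<ge> 2}"

definition twin_group :: "nat \<Rightarrow> nat word set monoid" where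
  "twin_group n = presented_group {1..<n} (twin_relations n)"

lemma group_twin_group: "group (twin_group n)"
  unfolding twin_group_def by (rule group_presented_group)

definition involutions :: "('a, 'b) monoid_scheme \<Rightarrow> 'a set" where
  "involutions G = {x \<in> carrier G. group.ord G x = 2}"

text \<open>
  The orbit of \<open>x\<close> under the conjugation action, as in the library theorem
  \<open>group.action_by_conjugation\<close>, is the conjugacy class of \<open>x\<close>.
\<close>

definition involution_classes :: "('a, 'b) monoid_scheme \<Rightarrow> 'a set set" where
  "involution_classes G =
    orbits G (involutions G) (\<lambda>g. \<lambda>h \<in> carrier G. g \<otimes>\<^bsub>G\<^esub> h \<otimes>\<^bsub>G\<^esub> inv\<^bsub>G\<^esub> g)"

text \<open>
  \<open>card\<close> of an infinite set is 0, so a nonzero value of \<open>\<rho> n\<close> entails that there are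
  finitely many classes.
\<close>

definition \<rho> :: "nat \<Rightarrow> nat" where
  "\<rho> n = card (involution_classes (twin_group n))"

end

theory Submission
  imports Defs
begin

text \<open>
  The twin group is a right-angled Coxeter group. Its word problem is solved by cancellation: a
  nonempty word that represents \<open>1\<close> contains two occurrences of a letter \<open>s\<close> such that \<open>s\<close> commutes
  with every letter between them. To see this, encode a word by its projections to all pairs of
  noncommuting letters; the generators act by involutions on the codes of reduced words, and a
  reduced word sends the code of the empty word to its own code. Applying cancellation
  to \<open>w w = 1\<close> either shortens \<open>w\<close> up to conjugation or splits off a letter that commutes with all
  of \<open>w\<close>, so every involution is conjugate to a product of pairwise commuting distinct generators.
  The parities of the letter counts tell these products apart. Hence \<open>\<rho> n\<close> is the
  number of nonempty sets of pairwise nonadjacent elements of \<open>{1..<n}\<close>.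
\<close>

section \<open>The word problem in right-angled Coxeter groups\<close>

definition racg_relations :: "'a set \<Rightarrow> ('a \<Rightarrow> 'a \<Rightarrow> bool) \<Rightarrow> ('a word \<times> 'a word) set" where
  "racg_relations S C =
    {([(s, True), (s, True)], []) | s. s \<in> S} \<union>
    {([(s, True), (t, True)], [(t, True), (s, True)]) | s t. s \<in> S \<and> t \<in> S \<and> C s t}"

locale right_angled =
  fixes S :: "'a set" and C :: "'a \<Rightarrow> 'a \<Rightarrow> bool"
  assumes C_sym: "C s t \<Longrightarrow> C t s"
    and C_irrefl: "\<not> C s s"
begin

section \<open>Codes of words by projections to pairs of letters\<close>

text \<open>Commuting pairs get the default \<open>[]\<close>, so swapping adjacent commuting
  letters does not change the code. The pairs with \<open>a = b\<close> are kept and record how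
  often \<open>a\<close> occurs.\<close>

definition proj :: "'a list \<Rightarrow> 'a \<Rightarrow> 'a \<Rightarrow> 'a list" where
  "proj xs a b = (if C a b then [] else filter (\<lambda>x. x = a \<or> x = b) xs)"

text \<open>Stated for arbitrary codes, so that \<open>act\<close> depends on the code alone. On the
  code of a word it means that some \<open>s\<close> can be commuted to the front.\<close>

definition starts :: "'a \<Rightarrow> ('a \<Rightarrow> 'a \<Rightarrow> 'a list) \<Rightarrow> bool" where
  "starts s P \<longleftrightarrow> (\<forall>t. \<not> C s t \<longrightarrow> (\<exists>zs. P s t = s # zs))"

text \<open>This models left multiplication by \<open>s\<close>: cancel an \<open>s\<close> that can
  be brought to the front, or else prepend one.\<close>

definition act :: "'a \<Rightarrow> ('a \<Rightarrow> 'a \<Rightarrow> 'a list) \<Rightarrow> 'a \<Rightarrow> 'a \<Rightarrow> 'a list" where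
  "act s P = (\<lambda>a b. if \<not> C a b \<and> (a = s \<or> b = s)
    then (if starts s P then tl (P a b) else s # P a b) else P a b)"

fun reduced :: "'a list \<Rightarrow> bool" where
  "reduced [] \<longleftrightarrow> True"
| "reduced (s # xs) \<longleftrightarrow> reduced xs \<and> \<not> starts s (proj xs)"

text \<open>Take the first \<open>s\<close> in \<open>xs\<close>, which exists by the pair
  \<open>s\<close>, \<open>s\<close>. A letter before it that did not commute with \<open>s\<close>
  would precede it in their common projection.\<close>

lemma starts_proj_iff:
  "starts s (proj xs) \<longleftrightarrow> (\<exists>a b. xs = a @ s # b \<and> (\<forall>x\<in>set a. C s x))"
proof
  assume st: "starts s (proj xs)"
  then obtain zs where "proj xs s s = s # zs" using C_irrefl by (auto simp: starts_def)
  then have "filter (\<lambda>x. x = s) xs = s # zs" by (simp add: proj_def C_irrefl)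
  then have "s \<in> set xs" by (metis (mono_tags) filter_is_subset list.set_intros(1) subsetD)
  then obtain a b where ab: "xs = a @ s # b" "s \<notin> set a" by (meson split_list_first)
  have "C s x" if x: "x \<in> set a" for x
  proof (rule ccontr)
    assume n: "\<not> C s x"
    then obtain zs where zs: "filter (\<lambda>y. y = s \<or> y = x) xs = s # zs"
      using st by (auto simp: starts_def proj_def)
    have "filter (\<lambda>y. y = s \<or> y = x) a \<noteq> []" using x by (auto simp: filter_empty_conv)
    then obtain y ys where y: "filter (\<lambda>y. y = s \<or> y = x) a = y # ys" by (meson list.exhaust)
    then have "y \<in> set a" by (metis (mono_tags) filter_is_subset list.set_intros(1) subsetD)
    moreover have "y = s" using zs y ab(1) by simp
    ultimately show False using ab(2) by simp
  qed
  then show "\<exists>a b. xs = a @ s # b \<and> (\<forall>x\<in>set a. C s x)" using ab(1) by blast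
next
  assume "\<exists>a b. xs = a @ s # b \<and> (\<forall>x\<in>set a. C s x)"
  then obtain a b where ab: "xs = a @ s # b" "\<forall>x\<in>set a. C s x" by blast
  show "starts s (proj xs)" unfolding starts_def
  proof (intro allI impI)
    fix t assume t: "\<not> C s t"
    then have "filter (\<lambda>x. x = s \<or> x = t) a = []"
      using ab(2) C_irrefl by (auto simp: filter_empty_conv)
    then show "\<exists>zs. proj xs s t = s # zs" using t by (simp add: proj_def ab(1))
  qed
qed

lemma proj_commute:
  assumes "\<forall>x\<in>set a. C s x"
  shows "proj (a @ s # b) = proj (s # a @ b)"
proof (intro ext)
  fix p q
  have "filter (\<lambda>x. x = p \<or> x = q) a = []" if "\<not> C p q" "s = p \<or> s = q"
    using that assms C_irrefl C_sym by (auto simp: filter_empty_conv)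
  then show "proj (a @ s # b) p q = proj (s # a @ b) p q" by (auto simp: proj_def)
qed

text \<open>\<open>starts x\<close> looks only at pairs of \<open>x\<close> with a letter not
  commuting with \<open>x\<close>, and \<open>s\<close> belongs to none of them.\<close>

lemma starts_proj_delete:
  assumes "C s x"
  shows "starts x (proj (a @ s # b)) \<longleftrightarrow> starts x (proj (a @ b))"
proof -
  have "proj (a @ s # b) x t = proj (a @ b) x t" if "\<not> C x t" for t
    using that assms C_irrefl C_sym by (auto simp: proj_def)
  then show ?thesis by (auto simp: starts_def)
qed

lemma starts_proj_append:
  assumes "\<forall>x\<in>set a. C s x"
  shows "starts s (proj (a @ b)) \<longleftrightarrow> starts s (proj b)"
  using assms
proof (induction a)
  case (Cons x a)
  then show ?case using starts_proj_delete[of x s "[]" "a @ b"] C_sym by auto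
qed simp

lemma reduced_appendD: "reduced (a @ b) \<Longrightarrow> reduced b"
  by (induction a) auto

lemma reduced_delete:
  assumes "reduced (a @ s # b)" "\<forall>x\<in>set a. C s x"
  shows "reduced (a @ b)"
  using assms by (induction a) (auto simp: starts_proj_delete)

text \<open>The shortest suffix that is not reduced begins with a letter that
  \<open>starts_proj_iff\<close> finds again further on; these two form the cancelling pair.\<close>

lemma not_reduced:
  assumes "\<not> reduced xs"
  obtains a s b c where "xs = a @ s # b @ s # c" "\<forall>x\<in>set b. C s x"
proof -
  have "\<exists>a s b c. xs = a @ s # b @ s # c \<and> (\<forall>x\<in>set b. C s x)"
    using assms
  proof (induction xs)
    case (Cons t xs)
    show ?case
    proof (cases "reduced xs")
      case True
      then have "starts t (proj xs)" using Cons.prems by simp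
      then obtain b c where "xs = b @ t # c" "\<forall>x\<in>set b. C t x" by (auto simp: starts_proj_iff)
      then show ?thesis
        by (intro exI[of _ "[]"] exI[of _ t] exI[of _ b] exI[of _ c]) simp
    next
      case False
      then obtain a s b c where "xs = a @ s # b @ s # c" "\<forall>x\<in>set b. C s x"
        using Cons.IH by blast
      then show ?thesis
        by (intro exI[of _ "t # a"] exI[of _ s] exI[of _ b] exI[of _ c]) simp
    qed
  qed simp
  then show thesis using that by blast
qed

section \<open>The action on codes of reduced words\<close>

lemma act_proj_add: "\<not> starts s (proj xs) \<Longrightarrow> act s (proj xs) = proj (s # xs)"
  by (intro ext) (auto simp: act_def proj_def)

lemma act_proj_delete: "act s (proj (s # xs)) = proj xs"
proof -
  have "starts s (proj (s # xs))" by (auto simp: starts_def proj_def)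
  then show ?thesis by (intro ext) (auto simp: act_def proj_def)
qed

text \<open>When \<open>s\<close> is deleted from \<open>a @ s # b\<close>, reducedness of
  \<open>s # b\<close> prevents \<open>s\<close> from starting \<open>b\<close>, hence also
  \<open>a @ b\<close>; so a second application puts \<open>s\<close> back.\<close>

lemma act_reduced:
  assumes "reduced xs"
  obtains ys where "reduced ys" "act s (proj xs) = proj ys" "act s (proj ys) = proj xs"
proof (cases "starts s (proj xs)")
  case True
  then obtain a b where ab: "xs = a @ s # b" "\<forall>x\<in>set a. C s x" by (auto simp: starts_proj_iff)
  have "\<not> starts s (proj b)" using reduced_appendD[of a "s # b"] assms ab(1) by simp
  then have "\<not> starts s (proj (a @ b))" using starts_proj_append ab(2) by blast
  moreover have "proj xs = proj (s # a @ b)" using proj_commute ab by simp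
  ultimately show ?thesis
    using reduced_delete assms ab that[of "a @ b"] act_proj_add act_proj_delete by metis
next
  case False
  then show ?thesis using assms that[of "s # xs"] act_proj_add act_proj_delete by simp
qed

text \<open>No noncommuting pair contains both \<open>s\<close> and \<open>t\<close>. Hence each
  action changes entries that the other neither tests nor changes.\<close>

lemma act_commute:
  assumes "C s t"
  shows "act s (act t P) = act t (act s P)"
proof -
  have ts: "C t s" "s \<noteq> t" using assms C_sym C_irrefl by auto
  have 1: "starts s (act t P) = starts s P"
    using assms ts by (auto simp: starts_def act_def)
  have 2: "starts t (act s P) = starts t P"
    using assms ts by (auto simp: starts_def act_def)
  show ?thesis
    by (intro ext) (use assms ts in \<open>auto simp: act_def[of _ "act _ _"] 1 2, auto simp: act_def\<close>)
qed

text \<open>Codes of reduced words are the right domain: on the code of \<open>[s, s]\<close>, two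
  applications of \<open>act s\<close> would delete both letters.\<close>

lemma act_states:
  assumes "P \<in> proj ` Collect reduced"
  shows "act s P \<in> proj ` Collect reduced" "act s (act s P) = P"
proof -
  obtain xs where "reduced xs" "P = proj xs" using assms by blast
  then show "act s P \<in> proj ` Collect reduced" "act s (act s P) = P"
    using act_reduced[of xs s] by (metis imageI mem_Collect_eq)+
qed

lemma foldr_act_states:
  "P \<in> proj ` Collect reduced \<Longrightarrow> foldr act xs P \<in> proj ` Collect reduced"
  by (induction xs) (auto simp: act_states)

text \<open>The actions satisfy the defining relations. Dropping the signs by \<open>map fst\<close>
  is sound because each generator acts as its own inverse.\<close>

lemma pres_cong_foldr_act:
  assumes "(u, v) \<in> pres_cong S (racg_relations S C)" "P \<in> proj ` Collect reduced"
  shows "foldr act (map fst u) P = foldr act (map fst v) P"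
  using assms
proof (induction arbitrary: P rule: pres_cong.induct)
  case (cancel x y s b)
  then show ?case by (simp add: act_states foldr_act_states)
next
  case (relation x y u v)
  have "foldr act (map fst u) Q = foldr act (map fst v) Q"
    if "Q \<in> proj ` Collect reduced" for Q
    using relation(3) that act_states(2)[OF that]
    by (auto simp: racg_relations_def intro: act_commute)
  then show ?case using relation.prems by (simp add: foldr_act_states)
qed auto

text \<open>Cancellations and relations change every letter count by an even number.\<close>

lemma pres_cong_parity:
  assumes "(u, v) \<in> pres_cong S (racg_relations S C)"
  shows "odd (count_list (map fst u) s) \<longleftrightarrow> odd (count_list (map fst v) s)"
  using assms by (induction rule: pres_cong.induct) (auto simp: racg_relations_def split: if_splits)

lemma foldr_act_reduced: "reduced xs \<Longrightarrow> foldr act xs (proj []) = proj xs"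
  by (induction xs) (auto simp: act_proj_add)

lemma proj_eq_Nil: "proj xs = proj [] \<Longrightarrow> xs = []"
proof (cases xs)
  case (Cons s ys)
  assume "proj xs = proj []"
  then have "proj xs s s = proj [] s s" by simp
  then show ?thesis by (simp add: proj_def C_irrefl Cons)
qed

section \<open>Evaluation of positive words in the group\<close>

abbreviation G where "G \<equiv> presented_group S (racg_relations S C)"

definition ev :: "'a list \<Rightarrow> 'a word set" where
  "ev xs = pres_cong S (racg_relations S C) `` {map (\<lambda>s. (s, True)) xs}"

lemma letters_words: "map (\<lambda>s. (s, True)) xs \<in> words S \<longleftrightarrow> xs \<in> lists S"
  by (induction xs) auto

lemma ev_eq_iff:
  assumes "xs \<in> lists S" "ys \<in> lists S"
  shows "ev xs = ev ys \<longleftrightarrow>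
    (map (\<lambda>s. (s, True)) xs, map (\<lambda>s. (s, True)) ys) \<in> pres_cong S (racg_relations S C)"
  unfolding ev_def using assms
  by (intro eq_equiv_class_iff[OF equiv_pres_cong]) (auto simp: letters_words)

lemma ev_append: "xs \<in> lists S \<Longrightarrow> ys \<in> lists S \<Longrightarrow> ev (xs @ ys) = ev xs \<otimes>\<^bsub>G\<^esub> ev ys"
  by (simp add: ev_def presented_group_mult letters_words)

lemma ev_Nil: "ev [] = \<one>\<^bsub>G\<^esub>"
  by (simp add: ev_def presented_group_def)

lemma ev_closed: "xs \<in> lists S \<Longrightarrow> ev xs \<in> carrier G"
  by (auto simp: ev_def presented_group_def letters_words intro: quotientI)

lemma letters_pos:
  assumes "w \<in> words S"
  shows "(w, map (\<lambda>s. (s, True)) (map fst w)) \<in> pres_cong S (racg_relations S C)"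
  using assms
proof (induction w)
  case Nil
  then show ?case by (simp add: pres_cong.refl)
next
  case (Cons a w)
  let ?R = "racg_relations S C"
  obtain s b where a: "a = (s, b)" by (cases a)
  have s: "s \<in> S" "w \<in> words S" using Cons.prems a by auto
  have "([(s, b)], [(s, True)]) \<in> pres_cong S ?R"
  proof (cases b)
    case True
    then show ?thesis using s by (auto intro: pres_cong.refl)
  next
    case False
    \<comment> \<open>The word \<open>s s s^-1\<close> equals \<open>s^-1\<close> by the relation
      and \<open>s\<close> by cancellation.\<close>
    have "([] @ [(s, True), (s, True)] @ [(s, False)], [] @ [] @ [(s, False)]) \<in> pres_cong S ?R"
      by (rule pres_cong.relation) (use s in \<open>auto simp: racg_relations_def\<close>)
    moreover have "([(s, True)] @ [(s, True), (s, \<not> True)] @ [], [(s, True)] @ []) \<in> pres_cong S ?R"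
      by (rule pres_cong.cancel) (use s in auto)
    ultimately show ?thesis using False by (auto intro: pres_cong.sym pres_cong.trans)
  qed
  from pres_cong_append[OF this Cons.IH[OF s(2)]] show ?case by (simp add: a)
qed

lemma carrier_ev: "carrier G = ev ` lists S"
proof
  show "ev ` lists S \<subseteq> carrier G" using ev_closed by blast
  show "carrier G \<subseteq> ev ` lists S"
  proof
    fix x assume "x \<in> carrier G"
    then obtain w where w: "w \<in> words S" "x = pres_cong S (racg_relations S C) `` {w}"
      by (auto simp: presented_group_def quotient_def)
    have "x = ev (map fst w)" unfolding ev_def w(2)
      by (intro equiv_class_eq[OF equiv_pres_cong] letters_pos w(1))
    moreover have "map fst w \<in> lists S"
      using w(1) by (force simp: words_def)
    ultimately show "x \<in> ev ` lists S" by blast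
  qed
qed

text \<open>A word representing \<open>1\<close> fixes the code of the empty word, while a reduced
  word sends it to its own code.\<close>

lemma ev_eq_one_reduced:
  assumes "xs \<in> lists S" "ev xs = \<one>\<^bsub>G\<^esub>" "reduced xs"
  shows "xs = []"
proof -
  have "(map (\<lambda>s. (s, True)) xs, []) \<in> pres_cong S (racg_relations S C)"
    using assms ev_eq_iff[of xs "[]"] by (simp add: ev_Nil)
  moreover have "proj [] \<in> proj ` Collect reduced" by simp
  ultimately have "foldr act xs (proj []) = proj []"
    using pres_cong_foldr_act by (fastforce simp: comp_def)
  then show ?thesis using assms(3) by (simp add: foldr_act_reduced proj_eq_Nil)
qed

lemma ev_parity:
  assumes "xs \<in> lists S" "ys \<in> lists S" "ev xs = ev ys"
  shows "odd (count_list xs s) \<longleftrightarrow> odd (count_list ys s)"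
  using pres_cong_parity[of "map (\<lambda>s. (s, True)) xs" "map (\<lambda>s. (s, True)) ys" s] assms
  by (simp add: ev_eq_iff comp_def)

lemma ev_cong:
  assumes "ev u = ev v" "u \<in> lists S" "v \<in> lists S" "a \<in> lists S" "b \<in> lists S"
  shows "ev (a @ u @ b) = ev (a @ v @ b)"
  using assms by (simp add: ev_append)

lemma ev_double: "s \<in> S \<Longrightarrow> ev [s, s] = ev []"
  using pres_cong.relation[of "[]" S "[]" "[(s, True), (s, True)]" "[]" "racg_relations S C"]
  by (subst ev_eq_iff) (auto simp: racg_relations_def)

lemma ev_swap: "s \<in> S \<Longrightarrow> t \<in> S \<Longrightarrow> C s t \<Longrightarrow> ev [s, t] = ev [t, s]"
  using pres_cong.relation[of "[]" S "[]" "[(s, True), (t, True)]" "[(t, True), (s, True)]"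
      "racg_relations S C"]
  by (subst ev_eq_iff) (auto simp: racg_relations_def)

lemma ev_commute:
  assumes "s \<in> S" "a \<in> lists S" "b \<in> lists S" "\<forall>x\<in>set a. C s x"
  shows "ev (a @ s # b) = ev (s # a @ b)"
  using assms
proof (induction a)
  case (Cons x a)
  have "ev ([x] @ (a @ s # b) @ []) = ev ([x] @ (s # a @ b) @ [])"
    by (rule ev_cong) (use Cons in auto)
  moreover have "ev [x, s] = ev [s, x]" using Cons.prems ev_swap[of s x] by simp
  then have "ev ([] @ [x, s] @ (a @ b)) = ev ([] @ [s, x] @ (a @ b))"
    by (rule ev_cong) (use Cons in auto)
  ultimately show ?case by simp
qed simp

lemma ev_cancel:
  assumes "s \<in> S" "a \<in> lists S" "b \<in> lists S" "c \<in> lists S" "\<forall>x\<in>set b. C s x"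
  shows "ev (a @ s # b @ s # c) = ev (a @ b @ c)"
proof -
  have "ev (a @ [s] @ (b @ s # c)) = ev (a @ [s] @ (s # b @ c))"
    using assms ev_cong[of "b @ s # c" "s # b @ c" "a @ [s]" "[]"] ev_commute by simp
  also have "\<dots> = ev (a @ b @ c)"
    using assms ev_cong[of "[s, s]" "[]" a "b @ c"] ev_double by simp
  finally show ?thesis by simp
qed

lemma ev_append_rev: "xs \<in> lists S \<Longrightarrow> ev (xs @ rev xs) = ev []"
proof (induction xs)
  case (Cons s xs)
  have "ev ([s] @ (xs @ rev xs) @ [s]) = ev ([s] @ [] @ [s])"
    by (rule ev_cong) (use Cons in auto)
  then show ?case using Cons ev_double by simp
qed simp

lemma inv_ev:
  assumes "xs \<in> lists S"
  shows "inv\<^bsub>G\<^esub> (ev xs) = ev (rev xs)"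
proof -
  interpret group G by (rule group_presented_group)
  have r: "rev xs \<in> lists S" using assms by auto
  have "ev (rev xs) \<otimes>\<^bsub>G\<^esub> ev xs = \<one>\<^bsub>G\<^esub>"
    using ev_append_rev[of "rev xs"] ev_append[of "rev xs" xs] assms r by (simp add: ev_Nil)
  then show ?thesis using assms r by (intro inv_equality) (auto simp: ev_closed)
qed

lemma conj_ev:
  assumes "g \<in> lists S" "xs \<in> lists S"
  shows "ev g \<otimes>\<^bsub>G\<^esub> ev xs \<otimes>\<^bsub>G\<^esub> inv\<^bsub>G\<^esub> (ev g) = ev (g @ xs @ rev g)"
proof -
  interpret group G by (rule group_presented_group)
  have r: "rev g \<in> lists S" using assms by auto
  show ?thesis using assms r by (simp add: inv_ev ev_append m_assoc ev_closed)
qed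

lemma ev_sq_cong:
  assumes "ev u = ev v" "u \<in> lists S" "v \<in> lists S" "ev (u @ u) = ev []"
  shows "ev (v @ v) = ev []"
  using assms by (simp add: ev_append)

section \<open>Involutions up to conjugacy\<close>

text \<open>
  The restriction on the letters of the conjugator \<open>g\<close> keeps it in the centralizer of a letter
  that has been split off.
\<close>

lemma involution_word_conj_clique:
  assumes "w \<in> lists S" "ev (w @ w) = ev []"
  shows "\<exists>g v. set g \<subseteq> set w \<and> set v \<subseteq> set w \<and> distinct v \<and> pairwise C (set v)
    \<and> ev w = ev (g @ v @ rev g)"
  using assms
proof (induction w rule: length_induct)
  case (1 w)
  note IH = 1(1)[rule_format] and wS = 1(2) and sq = 1(3)
  \<comment> \<open>A shorter word for the same element, with letters from \<open>w\<close>,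
    inherits the hypotheses, and its conjugator meets the restriction on letters.\<close>
  have shorten: ?case if w': "length w' < length w" "set w' \<subseteq> set w" "ev w = ev w'" for w'
  proof -
    have "w' \<in> lists S" using wS w'(2) by auto
    moreover from this have "ev (w' @ w') = ev []" using ev_sq_cong w'(3) wS sq by blast
    ultimately show ?thesis using IH[OF w'(1)] w'(2,3) by (metis subset_trans)
  qed
  show ?case
  proof (cases "w = []")
    case True
    then show ?thesis by (intro exI[of _ "[]"]) simp
  next
    case False
    then have "\<not> reduced (w @ w)"
      using ev_eq_one_reduced[of "w @ w"] wS sq by (auto simp: ev_Nil)
    then obtain a s b c where dec: "w @ w = a @ s # b @ s # c" and b: "\<forall>x\<in>set b. C s x"
      by (rule not_reduced)
    have "s \<in> set (w @ w)" unfolding dec by simp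
    then have s: "s \<in> set w" "s \<in> S" using wS by auto
    \<comment> \<open>The cancelling pair lies in the first copy of \<open>w\<close>, in the second
      copy, or has one letter in each.\<close>
    consider (left) c' where "w = a @ s # b @ s # c'"
      | (right) a' where "w = a' @ s # b @ s # c"
      | (mid) b1 b2 where "w = a @ s # b1" "w = b2 @ s # c" "b = b1 @ b2"
    proof -
      from dec consider us where "w = a @ us" "us @ w = s # b @ s # c"
        | us where "a = w @ us" "w = us @ s # b @ s # c"
        by (auto simp: append_eq_append_conv2)
      then show thesis
      proof cases
        case (1 us)
        show thesis
        proof (cases us)
          case Nil
          then show thesis using right[of "[]"] 1 by simp
        next
          case (Cons t vs)
          then have vs: "w = a @ s # vs" "vs @ w = b @ s # c" using 1 by auto
          then consider ts where "vs = b @ ts" "ts @ w = s # c"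
            | ts where "b = vs @ ts" "w = ts @ s # c"
            by (auto simp: append_eq_append_conv2)
          then show thesis
          proof cases
            case (1 ts)
            show thesis
            proof (cases ts)
              case Nil
              then show thesis using mid[of b "[]"] 1 vs by simp
            next
              case (Cons t' ts')
              then show thesis using left[of ts'] 1 vs by simp
            qed
          next
            case (2 ts)
            then show thesis using mid[of vs ts] vs by simp
          qed
        qed
      next
        case (2 us)
        then show thesis using right by blast
      qed
    qed
    then show ?thesis
    proof cases
      case left
      then show ?thesis using shorten[of "a @ b @ c'"] ev_cancel[of s a b c'] b wS by auto
    next
      case right
      then show ?thesis using shorten[of "a' @ b @ c"] ev_cancel[of s a' b c] b wS by auto
    next
      case mid
      have sb: "s \<notin> set b1" "s \<notin> set b2" "\<forall>x\<in>set b1. C s x" "\<forall>x\<in>set b2. C s x"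
        using b mid(3) C_irrefl by auto
      have "a @ s # b1 = b2 @ s # c" using mid by simp
      \<comment> \<open>Compare the positions in \<open>w\<close> of the two letters of the pair.
        The occurrence after \<open>b2\<close> cannot lie to the right of the one after
        \<open>a\<close>, since \<open>s\<close> is not in \<open>b2\<close>.\<close>
      then consider "a = b2" | d where "a = b2 @ s # d"
      proof -
        from \<open>a @ s # b1 = b2 @ s # c\<close> obtain us where
          "a = b2 @ us \<and> us @ s # b1 = s # c \<or> a @ us = b2 \<and> s # b1 = us @ s # c"
          by (auto simp: append_eq_append_conv2)
        then show thesis using that sb(2) by (cases us) auto
      qed
      then show ?thesis
      proof cases
        case 1
        have w: "w = b2 @ s # b1" using mid 1 by simp
        have ls: "b1 \<in> lists S" "b2 \<in> lists S" using wS w by auto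
        \<comment> \<open>Both letters come from one occurrence in \<open>w\<close>, and
          \<open>s\<close> commutes with all the others. So \<open>s\<close> splits off, and the
          rest still has trivial square.\<close>
        have ew: "ev w = ev ([s] @ b2 @ b1)" using ev_commute[of s b2 b1] w ls s sb by simp
        have "ev (([s] @ b2 @ b1) @ ([s] @ b2 @ b1)) = ev []"
          by (rule ev_sq_cong[OF ew]) (use wS sq s ls in auto)
        moreover have "ev ([] @ s # (b2 @ b1) @ s # (b2 @ b1)) = ev ([] @ (b2 @ b1) @ (b2 @ b1))"
          by (rule ev_cancel) (use s ls sb in auto)
        ultimately have "ev ((b2 @ b1) @ (b2 @ b1)) = ev []" by simp
        moreover have "length (b2 @ b1) < length w" using w by simp
        ultimately obtain g v where gv: "set g \<subseteq> set (b2 @ b1)" "set v \<subseteq> set (b2 @ b1)"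
          "distinct v" "pairwise C (set v)" "ev (b2 @ b1) = ev (g @ v @ rev g)"
          using IH[of "b2 @ b1"] ls by auto
        \<comment> \<open>The restriction on the letters of \<open>g\<close> and \<open>v\<close> is
          used here: \<open>s\<close> passes through \<open>g\<close> and joins
          \<open>v\<close>.\<close>
        have sg: "\<forall>x\<in>set g. C s x" "\<forall>x\<in>set v. C s x" "s \<notin> set v" using gv(1,2) sb by auto
        have gl: "g \<in> lists S" "v \<in> lists S" "rev g \<in> lists S" using gv(1,2) ls by auto
        have "ev w = ev ([s] @ g @ v @ rev g)"
          using ev_cong[OF gv(5), of "[s]" "[]"] ew ls gl s by simp
        also have "\<dots> = ev (g @ (s # v) @ rev g)"
          using ev_commute[of s g "v @ rev g"] s gl sg by simp
        finally have e: "ev w = ev (g @ (s # v) @ rev g)" .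
        have "pairwise C (set (s # v))"
          using gv(4) sg C_sym by (auto simp: pairwise_insert)
        moreover have "distinct (s # v)" using gv(3) sg(3) by simp
        moreover have "set g \<subseteq> set w" "set (s # v) \<subseteq> set w" using gv(1,2) w by auto
        ultimately show ?thesis using e by blast
      next
        case (2 d)
        have w: "w = b2 @ s # d @ s # b1" using mid 2 by simp
        let ?w = "b2 @ d @ b1"
        have ls: "b1 \<in> lists S" "b2 \<in> lists S" "d \<in> lists S" using wS w by auto
        \<comment> \<open>Two different occurrences move to the two ends of \<open>w\<close>,
          exhibiting it as the conjugate by \<open>s\<close> of the shorter word
          \<open>?w\<close>.\<close>
        have "ev w = ev (s # b2 @ d @ s # b1)" using ev_commute[of s b2 "d @ s # b1"] w ls s sb by simp
        also have "\<dots> = ev ((s # b2 @ d) @ (s # b1 @ []) @ [])" by simp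
        also have "\<dots> = ev ((s # b2 @ d) @ (b1 @ s # []) @ [])"
          by (rule ev_cong) (use ev_commute[of s b1 "[]"] ls s sb in auto)
        finally have ew: "ev w = ev ([s] @ ?w @ [s])" by simp
        have "ev (([s] @ ?w @ [s]) @ ([s] @ ?w @ [s])) = ev []"
          by (rule ev_sq_cong[OF ew]) (use wS sq s ls in auto)
        moreover have "ev (([s] @ ?w) @ s # [] @ s # (?w @ [s])) = ev (([s] @ ?w) @ [] @ ?w @ [s])"
          by (rule ev_cancel) (use s ls in auto)
        ultimately have "ev ([s] @ (?w @ ?w) @ [s]) = ev []" by simp
        \<comment> \<open>Multiplying by \<open>s\<close> on both sides leaves the square of
          \<open>?w\<close>.\<close>
        then have "ev ([s] @ ([s] @ (?w @ ?w) @ [s]) @ [s]) = ev ([s] @ [] @ [s])"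
          by (intro ev_cong) (use s ls in auto)
        moreover have "ev ([] @ [s, s] @ (?w @ ?w @ [s, s])) = ev ([] @ [] @ (?w @ ?w @ [s, s]))"
          by (rule ev_cong) (use ev_double s ls in auto)
        moreover have "ev ((?w @ ?w) @ [s, s] @ []) = ev ((?w @ ?w) @ [] @ [])"
          by (rule ev_cong) (use ev_double s ls in auto)
        ultimately have "ev (?w @ ?w) = ev []" using ev_double s by simp
        moreover have "length ?w < length w" using w by simp
        ultimately obtain g v where gv: "set g \<subseteq> set ?w" "set v \<subseteq> set ?w"
          "distinct v" "pairwise C (set v)" "ev ?w = ev (g @ v @ rev g)"
          using IH[of ?w] ls by auto
        have gl: "g \<in> lists S" "v \<in> lists S" "rev g \<in> lists S" using gv(1,2) ls by auto
        have "ev w = ev ((s # g) @ v @ rev (s # g))"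
          using ev_cong[OF gv(5), of "[s]" "[s]"] ew ls gl s by simp
        moreover have "set (s # g) \<subseteq> set w" "set v \<subseteq> set w" using gv(1,2) w by auto
        ultimately show ?thesis using gv(3,4) by blast
      qed
    qed
  qed
qed

section \<open>Products of pairwise commuting distinct generators\<close>

text \<open>The head of \<open>u\<close> can be commuted to the front of \<open>v\<close>; induction
  handles the tails.\<close>

lemma ev_clique_unique:
  assumes "distinct u" "distinct v" "set u = set v" "pairwise C (set u)" "u \<in> lists S"
  shows "ev u = ev v"
  using assms
proof (induction u arbitrary: v)
  case (Cons s u)
  then have "s \<in> set v" by auto
  then obtain p q where v: "v = p @ s # q" by (meson split_list)
  have vS: "set v \<subseteq> S" using Cons.prems by auto
  have "\<forall>x\<in>set p. C s x"
  proof
    fix x assume "x \<in> set p"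
    then have "x \<in> set (s # u)" "x \<noteq> s" using v Cons.prems by auto
    then show "C s x" using Cons.prems(4) by (auto simp: pairwise_def)
  qed
  then have "ev v = ev ([s] @ (p @ q))" using ev_commute[of s p q] v vS by auto
  moreover have "pairwise C (set u)" using Cons.prems(4) by (simp add: pairwise_insert)
  then have "ev u = ev (p @ q)"
    by (rule Cons.IH[rotated 3]) (use Cons.prems v in auto)
  ultimately show ?case
    using ev_cong[of u "p @ q" "[s]" "[]"] Cons.prems(5) v vS
    by (auto simp: lists_eq_set)
qed simp

text \<open>\<open>rev v\<close> lists the same clique, so \<open>v\<close> equals its own
  inverse.\<close>

lemma ev_clique_square:
  assumes "pairwise C (set v)" "distinct v" "v \<in> lists S"
  shows "ev (v @ v) = ev []"
proof -
  have "ev v = ev (rev v)" using assms by (intro ev_clique_unique) auto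
  moreover have "rev v \<in> lists S" using assms(3) by auto
  ultimately show ?thesis
    using assms(3) ev_append_rev[of v] ev_cong[of v "rev v" v "[]"] by simp
qed

lemma count_list_distinct: "distinct xs \<Longrightarrow> count_list xs s = (if s \<in> set xs then 1 else 0)"
  by (induction xs) auto

text \<open>\<open>g\<close> and \<open>rev g\<close> together contribute evenly to every letter
  count, and the parities of a distinct list determine its set.\<close>

lemma ev_conj_clique_eq:
  assumes "distinct u" "distinct v" "u \<in> lists S" "v \<in> lists S" "g \<in> lists S"
    "ev u = ev (g @ v @ rev g)"
  shows "set u = set v"
proof -
  have "rev g \<in> lists S" using assms(5) by auto
  then have "odd (count_list u s) \<longleftrightarrow> odd (count_list v s)" for s
    using ev_parity[of u "g @ v @ rev g" s] assms by (auto simp: count_list_rev)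
  then have "s \<in> set u \<longleftrightarrow> s \<in> set v" for s
    using assms(1,2) by (metis count_list_distinct even_zero odd_one)
  then show ?thesis by blast
qed

section \<open>Conjugacy classes of involutions\<close>

lemma ord_eq_2_iff:
  assumes "x \<in> carrier G"
  shows "group.ord G x = 2 \<longleftrightarrow> x \<noteq> \<one>\<^bsub>G\<^esub> \<and> x \<otimes>\<^bsub>G\<^esub> x = \<one>\<^bsub>G\<^esub>"
proof -
  interpret group G by (rule group_presented_group)
  have p: "x [^]\<^bsub>G\<^esub> (2::nat) = x \<otimes>\<^bsub>G\<^esub> x" using assms by (simp add: numeral_2_eq_2)
  show ?thesis
  proof
    assume o: "ord x = 2"
    then show "x \<noteq> \<one>\<^bsub>G\<^esub> \<and> x \<otimes>\<^bsub>G\<^esub> x = \<one>\<^bsub>G\<^esub>"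
      using p pow_ord_eq_1[OF assms] ord_id by auto
  next
    assume a: "x \<noteq> \<one>\<^bsub>G\<^esub> \<and> x \<otimes>\<^bsub>G\<^esub> x = \<one>\<^bsub>G\<^esub>"
    then have "ord x dvd 2" using pow_eq_id[OF assms, of 2] p by simp
    moreover have "ord x \<noteq> 1" using a ord_eq_1[OF assms] by simp
    ultimately show "ord x = 2" using prime_nat_iff two_is_prime_nat by blast
  qed
qed

definition conj_class :: "'a word set \<Rightarrow> 'a word set set" where
  "conj_class x = {g \<otimes>\<^bsub>G\<^esub> x \<otimes>\<^bsub>G\<^esub> inv\<^bsub>G\<^esub> g | g. g \<in> carrier G}"

lemma conj_class_ev:
  assumes "xs \<in> lists S"
  shows "conj_class (ev xs) = {ev (g @ xs @ rev g) | g. g \<in> lists S}"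
  unfolding conj_class_def carrier_ev using conj_ev[OF _ assms] by blast

lemma involution_classes_eq: "involution_classes G = conj_class ` involutions G"
proof -
  have "orbit G (\<lambda>g. \<lambda>h \<in> carrier G. g \<otimes>\<^bsub>G\<^esub> h \<otimes>\<^bsub>G\<^esub> inv\<^bsub>G\<^esub> g) x = conj_class x"
    if "x \<in> involutions G" for x
    using that by (auto simp: orbit_def conj_class_def involutions_def)
  then show ?thesis by (auto simp: involution_classes_def orbits_def image_iff)
qed

lemma conj_class_conj:
  assumes "g \<in> lists S" "xs \<in> lists S"
  shows "conj_class (ev (g @ xs @ rev g)) = conj_class (ev xs)"
proof -
  have gx: "g @ xs @ rev g \<in> lists S" using assms by auto
  show ?thesis unfolding conj_class_ev[OF gx] conj_class_ev[OF assms(2)]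
  proof (intro equalityI subsetI)
    fix y assume "y \<in> {ev (h @ (g @ xs @ rev g) @ rev h) | h. h \<in> lists S}"
    then obtain h where "h \<in> lists S" "y = ev ((h @ g) @ xs @ rev (h @ g))" by auto
    then show "y \<in> {ev (h @ xs @ rev h) | h. h \<in> lists S}" using assms
      by (intro CollectI exI[of _ "h @ g"]) simp
  next
    fix y assume "y \<in> {ev (h @ xs @ rev h) | h. h \<in> lists S}"
    then obtain h where h: "h \<in> lists S" "y = ev (h @ xs @ rev h)" by auto
    have r: "rev g \<in> lists S" "rev h \<in> lists S" using assms h by auto
    have gg: "ev (rev g @ g) = ev []" using ev_append_rev[of "rev g"] r by simp
    \<comment> \<open>The conjugator \<open>h @ rev g\<close> undoes the conjugation by
      \<open>g\<close>.\<close>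
    have "ev ((h @ rev g) @ (g @ xs @ rev g) @ rev (h @ rev g))
        = ev (h @ (rev g @ g) @ (xs @ rev g @ g @ rev h))" by simp
    also have "\<dots> = ev (h @ [] @ (xs @ rev g @ g @ rev h))"
      by (rule ev_cong[OF gg]) (use assms h r in auto)
    also have "\<dots> = ev ((h @ xs) @ (rev g @ g) @ rev h)" by simp
    also have "\<dots> = ev ((h @ xs) @ [] @ rev h)"
      by (rule ev_cong[OF gg]) (use assms h r in auto)
    finally have "y = ev ((h @ rev g) @ (g @ xs @ rev g) @ rev (h @ rev g))"
      using h(2) by simp
    then show "y \<in> {ev (h @ (g @ xs @ rev g) @ rev h) | h. h \<in> lists S}"
      using h(1) r by (intro CollectI exI[of _ "h @ rev g"]) simp
  qed
qed

lemma ev_mem_conj_class: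
  assumes "xs \<in> lists S"
  shows "ev xs \<in> conj_class (ev xs)"
  unfolding conj_class_ev[OF assms] by (intro CollectI exI[of _ "[]"]) simp

lemma involutions_ev_iff:
  assumes "xs \<in> lists S"
  shows "ev xs \<in> involutions G \<longleftrightarrow> ev xs \<noteq> ev [] \<and> ev (xs @ xs) = ev []"
  using assms ev_closed[OF assms] ord_eq_2_iff[of "ev xs"]
  by (simp add: involutions_def ev_append ev_Nil)

text \<open>The order chosen is immaterial on cliques, by \<open>ev_clique_unique\<close>.\<close>

definition enum_set :: "'a set \<Rightarrow> 'a list" where
  "enum_set A = (SOME xs. set xs = A \<and> distinct xs)"

lemma enum_set: "finite A \<Longrightarrow> set (enum_set A) = A \<and> distinct (enum_set A)"
  unfolding enum_set_def by (rule someI_ex) (rule finite_distinct_list)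

theorem bij_betw_cliques_involution_classes:
  "bij_betw (\<lambda>A. conj_class (ev (enum_set A)))
    {A. finite A \<and> A \<subseteq> S \<and> A \<noteq> {} \<and> pairwise C A} (involution_classes G)"
  unfolding bij_betw_def
proof
  let ?K = "{A. finite A \<and> A \<subseteq> S \<and> A \<noteq> {} \<and> pairwise C A}"
  have enum: "set (enum_set A) = A" "distinct (enum_set A)" "enum_set A \<in> lists S"
    if "A \<in> ?K" for A
    using that enum_set[of A] by auto
  show "inj_on (\<lambda>A. conj_class (ev (enum_set A))) ?K"
  proof (rule inj_onI)
    fix A B assume A: "A \<in> ?K" and B: "B \<in> ?K"
      and eq: "conj_class (ev (enum_set A)) = conj_class (ev (enum_set B))"
    have "ev (enum_set A) \<in> conj_class (ev (enum_set B))"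
      using ev_mem_conj_class[OF enum(3)[OF A]] eq by simp
    then obtain g where g: "g \<in> lists S" "ev (enum_set A) = ev (g @ enum_set B @ rev g)"
      unfolding conj_class_ev[OF enum(3)[OF B]] by blast
    have "set (enum_set A) = set (enum_set B)"
      by (rule ev_conj_clique_eq[OF enum(2)[OF A] enum(2)[OF B] enum(3)[OF A] enum(3)[OF B] g])
    then show "A = B" using enum(1) A B by simp
  qed
  show "(\<lambda>A. conj_class (ev (enum_set A))) ` ?K = involution_classes G"
    unfolding involution_classes_eq
  proof (intro equalityI subsetI)
    fix Y assume "Y \<in> (\<lambda>A. conj_class (ev (enum_set A))) ` ?K"
    then obtain A where A: "A \<in> ?K" "Y = conj_class (ev (enum_set A))" by blast
    have "ev (enum_set A) \<noteq> ev []"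
    proof
      assume "ev (enum_set A) = ev []"
      then have "set (enum_set A) = set []"
        using enum A(1) by (intro ev_conj_clique_eq[of _ _ "[]"]) auto
      then show False using enum(1)[OF A(1)] A(1) by simp
    qed
    moreover have "ev (enum_set A @ enum_set A) = ev []"
      using A(1) enum by (intro ev_clique_square) auto
    ultimately have "ev (enum_set A) \<in> involutions G"
      using involutions_ev_iff enum(3) A(1) by blast
    then show "Y \<in> conj_class ` involutions G" using A(2) by blast
  next
    fix Y assume "Y \<in> conj_class ` involutions G"
    then obtain x where x: "x \<in> involutions G" "Y = conj_class x" by blast
    then have "x \<in> carrier G" by (simp add: involutions_def)
    then obtain w where w: "w \<in> lists S" "x = ev w" unfolding carrier_ev by blast
    have inv: "ev w \<noteq> ev []" "ev (w @ w) = ev []" using involutions_ev_iff w x by auto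
    then obtain g v where gv: "set g \<subseteq> set w" "set v \<subseteq> set w" "distinct v"
      "pairwise C (set v)" "ev w = ev (g @ v @ rev g)"
      using involution_word_conj_clique[OF w(1)] by blast
    have gl: "g \<in> lists S" "v \<in> lists S" using gv(1,2) w(1) by auto
    have "v \<noteq> []" using gv(5) inv(1) ev_append_rev[OF gl(1)] by auto
    then have K: "set v \<in> ?K" using gl gv(4) by auto
    have "Y = conj_class (ev v)" using x(2) w(2) gv(5) conj_class_conj gl by simp
    also have "ev v = ev (enum_set (set v))"
      using enum[OF K] gv(3,4) gl(2) by (intro ev_clique_unique) auto
    finally show "Y \<in> (\<lambda>A. conj_class (ev (enum_set A))) ` ?K" using K by blast
  qed
qed

end

section \<open>Counting the classes in twin groups\<close>

text \<open>Keeping the empty set makes the cardinalities satisfy the Fibonacci recursion.\<close>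

definition sparse_sets :: "nat \<Rightarrow> nat set set" where
  "sparse_sets n = {A. A \<subseteq> {1..<n} \<and> pairwise (\<lambda>i j. \<bar>int i - int j\<bar> \<ge> 2) A}"

lemma finite_sparse_sets: "finite (sparse_sets n)"
  by (rule finite_subset[of _ "Pow {1..<n}"]) (auto simp: sparse_sets_def)

lemma empty_sparse_sets: "{} \<in> sparse_sets n"
  by (simp add: sparse_sets_def)

text \<open>Sparse sets are the cliques of the commutation relation; the \<open>1\<close> removes
  the empty set, which gives the identity.\<close>

lemma \<rho>_eq_card_sparse_sets: "\<rho> n = card (sparse_sets n) - 1"
proof -
  interpret right_angled "{1..<n}" "\<lambda>i j. \<bar>int i - int j\<bar> \<ge> 2"
    by unfold_locales auto
  have "twin_group n = G"
    by (simp add: twin_group_def twin_relations_def racg_relations_def)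
  moreover have "{A. finite A \<and> A \<subseteq> {1..<n} \<and> A \<noteq> {} \<and> pairwise (\<lambda>i j. \<bar>int i - int j\<bar> \<ge> 2) A}
      = sparse_sets n - {{}}"
    by (auto simp: sparse_sets_def intro: finite_subset)
  ultimately show ?thesis
    using bij_betw_same_card[OF bij_betw_cliques_involution_classes]
    by (simp add: \<rho>_def finite_sparse_sets empty_sparse_sets)
qed

lemma sparse_sets_0_1: "sparse_sets 0 = {{}}" "sparse_sets (Suc 0) = {{}}"
  by (auto simp: sparse_sets_def)

text \<open>Split by membership of the largest candidate \<open>Suc n\<close>: if it belongs to the
  set, then \<open>n\<close> does not, and a sparse subset of \<open>{1..<n}\<close>
  remains.\<close>

lemma card_sparse_sets_rec:
  "card (sparse_sets (Suc (Suc n))) = card (sparse_sets (Suc n)) + card (sparse_sets n)"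
proof -
  let ?i = "insert (Suc n)"
  have eq: "sparse_sets (Suc (Suc n)) = sparse_sets (Suc n) \<union> ?i ` sparse_sets n"
  proof (intro equalityI subsetI)
    fix A assume A: "A \<in> sparse_sets (Suc (Suc n))"
    show "A \<in> sparse_sets (Suc n) \<union> ?i ` sparse_sets n"
    proof (cases "Suc n \<in> A")
      case True
      have "A - {Suc n} \<subseteq> {1..<n}"
      proof
        fix i assume i: "i \<in> A - {Suc n}"
        then have "i \<in> {1..<Suc (Suc n)}" using A by (auto simp: sparse_sets_def)
        moreover have "\<bar>int i - int (Suc n)\<bar> \<ge> 2"
          using A True i unfolding sparse_sets_def by (blast dest: pairwiseD)
        ultimately show "i \<in> {1..<n}" by auto
      qed
      moreover have "pairwise (\<lambda>i j. \<bar>int i - int j\<bar> \<ge> 2) (A - {Suc n})"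
        using A by (auto simp: sparse_sets_def pairwise_def)
      ultimately have "A - {Suc n} \<in> sparse_sets n" unfolding sparse_sets_def by simp
      moreover have "A = ?i (A - {Suc n})" using True by auto
      ultimately show ?thesis by blast
    next
      case False
      then have "A \<subseteq> {1..<Suc n}" using A by (force simp: sparse_sets_def less_Suc_eq)
      then show ?thesis using A by (auto simp: sparse_sets_def)
    qed
  next
    fix A assume "A \<in> sparse_sets (Suc n) \<union> ?i ` sparse_sets n"
    then show "A \<in> sparse_sets (Suc (Suc n))"
    proof
      assume "A \<in> ?i ` sparse_sets n"
      then obtain B where B: "A = ?i B" "B \<in> sparse_sets n" by blast
      have "\<bar>int i - int (Suc n)\<bar> \<ge> 2 \<and> \<bar>int (Suc n) - int i\<bar> \<ge> 2" if "i \<in> B" for i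
        using that B(2) by (force simp: sparse_sets_def)
      then have "pairwise (\<lambda>i j. \<bar>int i - int j\<bar> \<ge> 2) A"
        using B by (simp add: sparse_sets_def pairwise_insert)
      moreover have "A \<subseteq> {1..<Suc (Suc n)}" using B by (force simp: sparse_sets_def)
      ultimately show ?thesis by (simp add: sparse_sets_def)
    qed (force simp: sparse_sets_def)
  qed
  have notin: "Suc n \<notin> A" if "A \<in> sparse_sets n \<or> A \<in> sparse_sets (Suc n)" for A
    using that by (auto simp: sparse_sets_def)
  then have "inj_on ?i (sparse_sets n)" by (intro inj_onI) (metis insert_ident)
  then have "card (?i ` sparse_sets n) = card (sparse_sets n)" by (rule card_image)
  moreover have "sparse_sets (Suc n) \<inter> ?i ` sparse_sets n = {}" using notin by auto
  ultimately show ?thesis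
    unfolding eq by (simp add: card_Un_disjoint finite_sparse_sets)
qed

theorem theorem4p4:
  shows "(\<forall>n::nat. n \<ge> 4 \<longrightarrow> \<rho> n = 1 + \<rho> (n - 1) + \<rho> (n - 2)) \<and> \<rho> 2 = 1 \<and> \<rho> 3 = 2"
proof (intro conjI allI impI)
  \<comment> \<open>Positivity makes the truncated subtraction exact, so passing from cardinalities
    to \<open>\<rho>\<close> produces the extra \<open>1\<close>.\<close>
  have pos: "card (sparse_sets n) \<ge> 1" for n
    using finite_sparse_sets empty_sparse_sets by (metis One_nat_def Suc_leI card_gt_0_iff empty_iff)
  show "\<rho> 2 = 1" "\<rho> 3 = 2"
    by (simp_all add: \<rho>_eq_card_sparse_sets numeral_2_eq_2 numeral_3_eq_3
        card_sparse_sets_rec sparse_sets_0_1)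
  fix n :: nat assume "n \<ge> 4"
  then obtain m where n: "n = Suc (Suc m)"
    by (metis add_2_eq_Suc le_Suc_ex numeral_Bit0 add.assoc)
  show "\<rho> n = 1 + \<rho> (n - 1) + \<rho> (n - 2)"
    using pos[of m] pos[of "Suc m"]
    by (simp add: n \<rho>_eq_card_sparse_sets card_sparse_sets_rec)
qed

end
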